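(* Let $S=\langle g_1,g_2,g_3\rangle$ be a $3$-generated numerical semigroup with $g_1<g_2<g_3$, let $R=K[[t^S]]$ with maximal ideal $\mathbf m$, and assume that $G(\mathbf m)$ is Buchsbaum. If $\omega_i=hg_2+kg_3$ (with $h,k\in\mathbb N$) is an element of $\mathrm{Ap}_{g_1}(S)$ such that $a_i>b_i$, then $h=0$. In particular, there is at most one element $\omega_i\in\mathrm{Ap}_{g_1}(S)$ such that $a_i>b_i$.
   Context: $K$ is an infinite field, and $\mathbb N$ includes $0$. $S\subseteq\mathbb N$ is the numerical semigroup with minimal generators $g_1<g_2<g_3$, $\gcd(g_1,g_2,g_3)=1$. $R=K[[t^S]]=K[[t^{g_1},t^{g_2},t^{g_3}]]$, $\mathbf m=(t^{g_1},t^{g_2},t^{g_3})$, $G(\mathbf m)=\bigoplus_{i\ge0}\mathbf m^i/\mathbf m^{i+1}$, and $\mathcal M$ is the homogeneous maximal ideal of $G(\mathbf m)$. $G(\mathbf m)$ is called Buchsbaum if $\mathcal M\cdot H^0_{\mathcal M}=0$, where $H^0_{\mathcal M}=\bigcup_{k\ge1}(0:_{G(\mathbf m)}\mathcal M^k)$. Apery set: $\mathrm{Ap}_{g_1}(S)=\{\omega_0,\dots,\omega_{g_1-1}\}$, where $\omega_i=\min\{s\in S: s\equiv i \bmod g_1\}$ (its elements are all of the form $hg_2+kg_3$). Let $S'=\langle g_1,g_2-g_1,g_3-g_1\rangle$ and $\omega'_i=\min\{s\in S': s\equiv i\bmod g_1\}$. Let $M=S\setminus\{0\}$, $lM=M+\dots+M$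 ($l$ summands), $0M=S$. For $0\le i\le g_1-1$, $a_i$ is the integer with $\omega'_i+a_ig_1=\omega_i$, and $b_i=\max\{l:\omega_i\in lM\}$; one always has $b_i\le a_i$. *)

theory Defs
  imports
    "HOL-Computational_Algebra.Formal_Power_Series"
    "HOL-Algebra.QuotRing"
    "HOL-Algebra.Ideal_Product"
begin

section \<open>Numerical semigroups\<close>

inductive_set semigroup_gen :: "nat set \<Rightarrow> nat set" for A :: "nat set" where
  zero: "0 \<in> semigroup_gen A"
| add: "a \<in> A \<Longrightarrow> s \<in> semigroup_gen A \<Longrightarrow> a + s \<in> semigroup_gen A"

definition minimal_generators :: "nat set \<Rightarrow> nat set \<Rightarrow> bool" where
  "minimal_generators A S \<longleftrightarrow>
     S = semigroup_gen A \<and> (\<forall>B. B \<subset> A \<longrightarrow> semigroup_gen B \<noteq> S)"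

definition apery :: "nat set \<Rightarrow> nat \<Rightarrow> nat \<Rightarrow> nat" where
  "apery S g i = (LEAST s. s \<in> S \<and> s mod g = i mod g)"

definition apery_a :: "nat set \<Rightarrow> nat set \<Rightarrow> nat \<Rightarrow> nat \<Rightarrow> int" where
  "apery_a S S' g i = (THE a. int (apery S' g i) + a * int g = int (apery S g i))"

text \<open>The set $lM = M + \dots + M$ with $M = S \setminus \{0\}$. By convention $0M$ is
  $S$ and not the empty sum $\{0\}$.\<close>
definition max_ideal_multiple :: "nat set \<Rightarrow> nat \<Rightarrow> nat set" where
  "max_ideal_multiple S l =
     (if l = 0 then S else {sum_list xs | xs. length xs = l \<and> set xs \<subseteq> S - {0}})"

text \<open>All summands of an element of $lM$ are positive, so $s \in lM$ implies $l \le s$ and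
  the maximum is taken over a finite set; for $s \in S$ that set contains $0$.\<close>
definition adic_order :: "nat set \<Rightarrow> nat \<Rightarrow> nat" where
  "adic_order S s = Max {l. s \<in> max_ideal_multiple S l}"

definition apery_b :: "nat set \<Rightarrow> nat \<Rightarrow> nat \<Rightarrow> nat" where
  "apery_b S g i = adic_order S (apery S g i)"


section \<open>Associated graded rings\<close>

fun ideal_power :: "('a, 'b) ring_scheme \<Rightarrow> 'a set \<Rightarrow> nat \<Rightarrow> 'a set" where
  "ideal_power R I 0 = carrier R"
| "ideal_power R I (Suc n) = ideal_prod R I (ideal_power R I n)"

text \<open>Elements of $\bigoplus_{i \ge 0} I^i / I^{i+1}$ are finitely supported sequences whose
  $i$-th entry is a coset of $I^{i+1}$ with representative in $I^i$. The zero of the $i$-th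
  summand is the coset $I^{i+1}$ itself. The product of $x + I^{i+1}$ and $y + I^{j+1}$ is
  $xy + I^{i+j+1}$; this is the union of the cosets of $I^{i+j+1}$ through the products of
  all representatives, as computed by \<^const>\<open>rcoset_mult\<close>.\<close>
definition assoc_graded :: "('a, 'b) ring_scheme \<Rightarrow> 'a set \<Rightarrow> (nat \<Rightarrow> 'a set) ring" where
  "assoc_graded R I =
     \<lparr> carrier = {f. (\<forall>i. \<exists>x \<in> ideal_power R I i. f i = ideal_power R I (Suc i) +>\<^bsub>R\<^esub> x) \<and>
                     finite {i. f i \<noteq> ideal_power R I (Suc i)}},
       mult = (\<lambda>f g n. \<Oplus>\<^bsub>R Quot ideal_power R I (Suc n)\<^esub> i \<in> {..n}.
                 rcoset_mult R (ideal_power R I (Suc n)) (f i) (g (n - i))),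
       one = (\<lambda>i. if i = 0 then ideal_power R I 1 +>\<^bsub>R\<^esub> \<one>\<^bsub>R\<^esub> else ideal_power R I (Suc i)),
       zero = (\<lambda>i. ideal_power R I (Suc i)),
       add = (\<lambda>f g i. f i <+>\<^bsub>R\<^esub> g i) \<rparr>"

text \<open>For a local ring $(R, I)$ the summand $R/I$ of degree $0$ is a field, and the homogeneous
  maximal ideal of the associated graded ring is $\bigoplus_{i \ge 1} I^i / I^{i+1}$.\<close>
definition homogeneous_max_ideal :: "('a, 'b) ring_scheme \<Rightarrow> 'a set \<Rightarrow> (nat \<Rightarrow> 'a set) set" where
  "homogeneous_max_ideal R I = {f \<in> carrier (assoc_graded R I). f 0 = ideal_power R I 1}"

definition annihilator :: "('a, 'b) ring_scheme \<Rightarrow> 'a set \<Rightarrow> 'a set" where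
  "annihilator G J = {x \<in> carrier G. \<forall>y \<in> J. x \<otimes>\<^bsub>G\<^esub> y = \<zero>\<^bsub>G\<^esub>}"

definition local_cohomology_0 :: "('a, 'b) ring_scheme \<Rightarrow> 'a set \<Rightarrow> 'a set" where
  "local_cohomology_0 G N = (\<Union>k \<in> {1..}. annihilator G (ideal_power G N k))"

definition graded_buchsbaum :: "('a, 'b) ring_scheme \<Rightarrow> 'a set \<Rightarrow> bool" where
  "graded_buchsbaum R I \<longleftrightarrow>
     (let G = assoc_graded R I; N = homogeneous_max_ideal R I
      in ideal_prod G N (local_cohomology_0 G N) = {\<zero>\<^bsub>G\<^esub>})"


section \<open>Semigroup rings\<close>

text \<open>$K[[t^S]]$ as the subring of $K[[t]]$ of all power series with support in $S$.\<close>
definition semigroup_ring :: "nat set \<Rightarrow> 'k::field fps ring" where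
  "semigroup_ring S =
     \<lparr> carrier = {f. \<forall>n. fps_nth f n \<noteq> 0 \<longrightarrow> n \<in> S},
       mult = (*), one = 1, zero = 0, add = (+) \<rparr>"

definition semigroup_max_ideal :: "nat set \<Rightarrow> nat set \<Rightarrow> 'k::field fps set" where
  "semigroup_max_ideal S A = Idl\<^bsub>semigroup_ring S\<^esub> ((\<lambda>g. fps_X ^ g) ` A)"

lemma semigroup_gen_closed:
  "x \<in> semigroup_gen A \<Longrightarrow> y \<in> semigroup_gen A \<Longrightarrow> x + y \<in> semigroup_gen A"
  by (induction rule: semigroup_gen.induct) (auto simp: add.assoc intro: semigroup_gen.add)

lemma cring_semigroup_ring:
  "cring (semigroup_ring (semigroup_gen A) :: 'k::field fps ring)"
proof (intro cringI abelian_groupI comm_monoidI)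
  let ?R = "semigroup_ring (semigroup_gen A) :: 'k fps ring"
  show "x \<otimes>\<^bsub>?R\<^esub> y \<in> carrier ?R" if "x \<in> carrier ?R" "y \<in> carrier ?R" for x y
  proof -
    have "n \<in> semigroup_gen A" if "fps_nth (x * y) n \<noteq> 0" for n
    proof -
      from that obtain i where "i \<le> n" "fps_nth x i * fps_nth y (n - i) \<noteq> 0"
        unfolding fps_mult_nth by (metis (no_types, lifting) atLeastAtMost_iff sum.neutral)
      with \<open>x \<in> carrier ?R\<close> \<open>y \<in> carrier ?R\<close> have "i + (n - i) \<in> semigroup_gen A"
        by (intro semigroup_gen_closed) (auto simp: semigroup_ring_def)
      with \<open>i \<le> n\<close> show ?thesis by simp
    qed
    then show ?thesis by (auto simp: semigroup_ring_def)
  qed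
  show "\<exists>y\<in>carrier ?R. y \<oplus>\<^bsub>?R\<^esub> x = \<zero>\<^bsub>?R\<^esub>" if "x \<in> carrier ?R" for x
    using that by (intro bexI[of _ "-x"]) (auto simp: semigroup_ring_def)
qed (auto simp: semigroup_ring_def algebra_simps semigroup_gen.zero,
     (metis add.right_neutral)?)

end

theory Submission
  imports Defs
begin

text \<open>Write $nM$ for the sums of at least $n$ generators, so that $t^s \in \mathbf m^n$ if and only if
  $s \in nM$. If $s \in bM$ and $s + c g_1 \in (b + c + 1)M$ for some $c$, then the class of $t^s$ in
  $\mathbf m^b / \mathbf m^{b+1}$ is annihilated by a power of $\mathcal M$: a long sum of
  generators either contains $c$ copies of $g_1$ or can be made longer. If $G(\mathbf m)$ is
  Buchsbaum, this class is therefore killed by the classes of all $t^{g_j}$, that is,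
  $s + g_j \in (b + 2)M$. The inequality $a_i > b_i$ provides such a $c$ for $s = \omega_i$,
  $b = b_i$.

  Suppose that $\omega_i = h g_2 + k g_3$ with $h + k = b_i$ and $h > 0$. A
  sum of at least $b_i + 2$ generators equal to $\omega_i + g_1$ cannot contain $g_1$ and, by size,
  does not consist of copies of $g_3$ only. Removing a summand $g_2$ gives
  $\omega_i - g_2 + g_1 \in (b_i + 1)M$, so the class of $t^{\omega_i - g_2}$ in degree $b_i - 1$ is
  torsion as well and $\omega_i = (\omega_i - g_2) + g_2 \in (b_i + 1)M$, a contradiction. Hence
  $\omega_i = b_i g_3$, and $\omega_i + g_3 \in (b_i + 2)M$ excludes a second, larger such element.\<close>

section \<open>The associated graded ring of an ideal\<close>

text \<open>This is the direct product of the quotients I^i / I^(i+1), where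
  \<open>assoc_graded\<close> has the direct sum. Dropping the finite support lets closure under
  sums and convolution products be checked degree by degree.\<close>

definition coset_sequences :: "('a, 'b) ring_scheme \<Rightarrow> 'a set \<Rightarrow> (nat \<Rightarrow> 'a set) set" where
  "coset_sequences R I =
     {f. \<forall>i. \<exists>a\<in>ideal_power R I i. f i = ideal_power R I (Suc i) +>\<^bsub>R\<^esub> a}"

text \<open>The homogeneous element of degree n given by the class of \<open>a\<close>. It is the
  zero element when \<open>a\<close> lies in I^(n+1), so \<open>a\<close> may have any order that is
  at least n.\<close>

definition initial_form :: "('a, 'b) ring_scheme \<Rightarrow> 'a set \<Rightarrow> nat \<Rightarrow> 'a \<Rightarrow> nat \<Rightarrow> 'a set" where
  "initial_form R I n a i =
     (if i = n then ideal_power R I (Suc n) +>\<^bsub>R\<^esub> a else ideal_power R I (Suc i))"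

lemma carrier_assoc_graded:
  "carrier (assoc_graded R I) =
     {f \<in> coset_sequences R I. finite {i. f i \<noteq> ideal_power R I (Suc i)}}"
  by (auto simp: assoc_graded_def coset_sequences_def)

declare ideal_power.simps(2) [simp del]

context cring
begin

section \<open>Powers of an ideal and their cosets\<close>

lemma ideal_power_is_ideal:
  assumes "ideal I R"
  shows "ideal (ideal_power R I n) R"
  by (induction n) (auto simp: ideal_power.simps(2) oneideal intro!: ideal_prod_is_ideal assms)

lemma ideal_power_Suc_subset:
  assumes "ideal I R"
  shows "ideal_power R I (Suc n) \<subseteq> ideal_power R I n"
  using ideal_prod_inter[OF assms ideal_power_is_ideal[OF assms]]
  by (auto simp: ideal_power.simps(2))

lemma ideal_power_mult_closed:
  assumes I: "ideal I R" and "a \<in> ideal_power R I i" and b: "b \<in> ideal_power R I j"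
  shows "a \<otimes> b \<in> ideal_power R I (i + j)"
  using assms(2)
proof (induction i arbitrary: a)
  case 0
  then show ?case
    using ideal.I_l_closed[OF ideal_power_is_ideal[OF I] b] by simp
next
  case (Suc i)
  have carr: "x \<in> carrier R" if "x \<in> ideal_power R I n" for x n
    using ideal.Icarr[OF ideal_power_is_ideal[OF I]] that .
  from Suc.prems have "a \<in> ideal_prod R I (ideal_power R I i)"
    by (simp add: ideal_power.simps(2))
  then show ?case
  proof induction
    case (prod x y)
    then have "x \<otimes> (y \<otimes> b) \<in> ideal_power R I (Suc i + j)"
      using Suc.IH by (auto simp: ideal_power.simps(2) intro: ideal_prod.prod)
    then show ?case
      using prod carr b ideal.Icarr[OF I] by (metis m_assoc)
  next
    case (sum x y)
    then have "x \<otimes> b \<oplus> y \<otimes> b \<in> ideal_power R I (Suc i + j)"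
      by (auto simp: ideal_power.simps(2) intro: ideal_prod.sum)
    moreover have "x \<in> carrier R" "y \<in> carrier R"
      using sum.hyps carr[of _ "Suc i"] by (auto simp: ideal_power.simps(2))
    ultimately show ?case
      using carr b by (simp add: l_distr)
  qed
qed

lemma ideal_coset_eq_iff:
  assumes "ideal J R" "x \<in> carrier R"
  shows "J +> x = J \<longleftrightarrow> x \<in> J"
proof -
  interpret J: ideal J R by fact
  show ?thesis
    using assms(2) J.rcos_const_imp_mem J.a_rcos_const by blast
qed

text \<open>Changing the representatives by u in I^(i+1) and v in I^(j+1) changes the product by u(v
  + c) + av, which lies in I^(i+j+1). So all cosets in the union that defines
  \<open>rcoset_mult\<close> coincide.\<close>

lemma rcoset_mult_ideal_power:
  assumes I: "ideal I R" and a: "a \<in> ideal_power R I i" and c: "c \<in> ideal_power R I j"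
  shows "rcoset_mult R (ideal_power R I (Suc (i + j)))
           (ideal_power R I (Suc i) +> a) (ideal_power R I (Suc j) +> c)
         = ideal_power R I (Suc (i + j)) +> (a \<otimes> c)"
proof -
  let ?P = "ideal_power R I"
  interpret J: ideal "?P (Suc (i + j))" R by (rule ideal_power_is_ideal[OF I])
  have carr: "x \<in> carrier R" if "x \<in> ?P n" for x n
    using ideal.Icarr[OF ideal_power_is_ideal[OF I]] that .
  have coset: "?P (Suc (i + j)) +> (u \<oplus> a) \<otimes> (v \<oplus> c) = ?P (Suc (i + j)) +> a \<otimes> c"
    if u: "u \<in> ?P (Suc i)" and v: "v \<in> ?P (Suc j)" for u v
  proof -
    note cs = carr[OF u] carr[OF v] carr[OF a] carr[OF c]
    have "v \<oplus> c \<in> ?P j"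
      using v c ideal_power_Suc_subset[OF I] ideal_power_is_ideal[OF I, of j]
      by (meson additive_subgroup.a_closed ideal_def subsetD)
    then have "u \<otimes> (v \<oplus> c) \<in> ?P (Suc (i + j))"
      using ideal_power_mult_closed[OF I u] by (metis add_Suc)
    moreover have "a \<otimes> v \<in> ?P (Suc (i + j))"
      using ideal_power_mult_closed[OF I a v] by (metis add_Suc_right)
    ultimately have "u \<otimes> (v \<oplus> c) \<oplus> a \<otimes> v \<in> ?P (Suc (i + j))"
      by (rule J.a_closed)
    moreover have "(u \<oplus> a) \<otimes> (v \<oplus> c) = (u \<otimes> (v \<oplus> c) \<oplus> a \<otimes> v) \<oplus> a \<otimes> c"
      using cs by (simp add: l_distr r_distr a_ac)
    ultimately have "(u \<oplus> a) \<otimes> (v \<oplus> c) \<in> ?P (Suc (i + j)) +> a \<otimes> c"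
      by (auto simp: a_r_coset_def')
    then show ?thesis
      using a_repr_independence[OF _ _ J.a_subgroup] cs by auto
  qed
  \<comment> \<open>The union runs over at least one pair of representatives, namely
    \<open>a\<close> and \<open>c\<close>; otherwise it would be empty.\<close>
  have "\<zero> \<oplus> a = a" "\<zero> \<oplus> c = c" using carr a c by auto
  moreover have "\<zero> \<in> ?P (Suc i)" "\<zero> \<in> ?P (Suc j)"
    using ideal_power_is_ideal[OF I] additive_subgroup.zero_closed ideal.axioms(1) by blast+
  ultimately have "a \<in> ?P (Suc i) +> a" "c \<in> ?P (Suc j) +> c"
    unfolding a_r_coset_def' by fastforce+
  moreover have "?P (Suc (i + j)) +> x \<otimes> y = ?P (Suc (i + j)) +> a \<otimes> c"
    if "x \<in> ?P (Suc i) +> a" "y \<in> ?P (Suc j) +> c" for x y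
    using that coset unfolding a_r_coset_def'[of _ "?P (Suc i)"] a_r_coset_def'[of _ "?P (Suc j)"]
    by blast
  ultimately show ?thesis
    unfolding rcoset_mult_def by blast
qed

section \<open>The convolution product of the associated graded ring\<close>

lemma assoc_graded_mult_component:
  "(f \<otimes>\<^bsub>assoc_graded R I\<^esub> g) n = (\<Oplus>\<^bsub>R Quot ideal_power R I (Suc n)\<^esub> i \<in> {..n}.
     rcoset_mult R (ideal_power R I (Suc n)) (f i) (g (n - i)))"
  by (simp add: assoc_graded_def)

lemma assoc_graded_add_component:
  "(f \<oplus>\<^bsub>assoc_graded R I\<^esub> g) n = f n <+> g n"
  by (simp add: assoc_graded_def)

lemma abelian_monoid_Quot: "ideal J R \<Longrightarrow> abelian_monoid (R Quot J)"
  using ideal.quotient_is_ring ring.is_abelian_group abelian_group.axioms(1) by blast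

text \<open>A vanishing factor has its representative one power deeper, which puts the product of
  representatives into I^(n+1). This discards summands of the convolution.\<close>

lemma rcoset_mult_zero:
  assumes I: "ideal I R" and n: "i \<le> n"
    and f: "f \<in> coset_sequences R I" and g: "g \<in> coset_sequences R I"
    and z: "f i = ideal_power R I (Suc i) \<or> g (n - i) = ideal_power R I (Suc (n - i))"
  shows "rcoset_mult R (ideal_power R I (Suc n)) (f i) (g (n - i)) = ideal_power R I (Suc n)"
proof -
  let ?P = "ideal_power R I"
  obtain a c where a: "a \<in> ?P i" "f i = ?P (Suc i) +> a"
    and c: "c \<in> ?P (n - i)" "g (n - i) = ?P (Suc (n - i)) +> c"
    using f g unfolding coset_sequences_def by blast
  have carr: "x \<in> carrier R" if "x \<in> ?P n" for x n
    using ideal.Icarr[OF ideal_power_is_ideal[OF I]] that .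
  have "a \<in> ?P (Suc i) \<or> c \<in> ?P (Suc (n - i))"
    using z a c carr ideal_coset_eq_iff[OF ideal_power_is_ideal[OF I]] by metis
  then have "a \<otimes> c \<in> ?P (Suc n)"
    using ideal_power_mult_closed[OF I _ c(1), of a "Suc i"]
      ideal_power_mult_closed[OF I a(1), of c "Suc (n - i)"] n by auto
  moreover have "rcoset_mult R (?P (Suc n)) (f i) (g (n - i)) = ?P (Suc n) +> a \<otimes> c"
    using rcoset_mult_ideal_power[OF I a(1) c(1)] n a c by simp
  ultimately show ?thesis
    using ideal_coset_eq_iff[OF ideal_power_is_ideal[OF I]] carr by metis
qed

lemma assoc_graded_mult_zero:
  assumes "\<And>i. i \<le> n \<Longrightarrow>
    rcoset_mult R (ideal_power R I (Suc n)) (f i) (g (n - i)) = ideal_power R I (Suc n)"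
    and "ideal I R"
  shows "(f \<otimes>\<^bsub>assoc_graded R I\<^esub> g) n = ideal_power R I (Suc n)"
proof -
  let ?J = "ideal_power R I (Suc n)"
  interpret Q: abelian_monoid "R Quot ?J"
    by (intro abelian_monoid_Quot ideal_power_is_ideal assms)
  have "?J = \<zero>\<^bsub>R Quot ?J\<^esub>" by (simp add: FactRing_def)
  then show ?thesis
    unfolding assoc_graded_mult_component
    using Q.add.finprod_one_eqI[of "{..n}" "\<lambda>i. rcoset_mult R ?J (f i) (g (n - i))"] assms(1)
    by (simp)
qed

lemma assoc_graded_mult_single:
  assumes "ideal I R" "j \<le> n"
    and "\<And>i. i \<le> n \<Longrightarrow> i \<noteq> j \<Longrightarrow>
      rcoset_mult R (ideal_power R I (Suc n)) (f i) (g (n - i)) = ideal_power R I (Suc n)"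
    and "c \<in> carrier R"
      "rcoset_mult R (ideal_power R I (Suc n)) (f j) (g (n - j)) = ideal_power R I (Suc n) +> c"
  shows "(f \<otimes>\<^bsub>assoc_graded R I\<^esub> g) n = ideal_power R I (Suc n) +> c"
proof -
  let ?J = "ideal_power R I (Suc n)"
  interpret J: ideal ?J R by (intro ideal_power_is_ideal assms)
  interpret Q: abelian_monoid "R Quot ?J"
    by (intro abelian_monoid_Quot ideal_power_is_ideal assms)
  have c: "?J +> c \<in> carrier (R Quot ?J)"
    using assms(4) by (simp add: FactRing_def a_rcosetsI J.a_subset)
  have "(f \<otimes>\<^bsub>assoc_graded R I\<^esub> g) n =
      (\<Oplus>\<^bsub>R Quot ?J\<^esub> i \<in> {..n}. if i = j then ?J +> c else \<zero>\<^bsub>R Quot ?J\<^esub>)"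
    unfolding assoc_graded_mult_component
    by (rule Q.add.finprod_cong') (use assms c Q.zero_closed in \<open>auto simp: FactRing_def\<close>)
  also have "\<dots> = ?J +> c"
    using Q.add.finprod_singleton_swap[of j "{..n}" "\<lambda>_. ?J +> c"] assms c by auto
  finally show ?thesis .
qed

lemma coset_sequences_mult_closed:
  assumes I: "ideal I R" and f: "f \<in> coset_sequences R I" and g: "g \<in> coset_sequences R I"
  shows "f \<otimes>\<^bsub>assoc_graded R I\<^esub> g \<in> coset_sequences R I"
  unfolding coset_sequences_def
proof (intro CollectI allI)
  fix n
  let ?P = "ideal_power R I" and ?J = "ideal_power R I (Suc n)"
  let ?F = "\<lambda>i. rcoset_mult R ?J (f i) (g (n - i))"
  interpret P: ideal "?P n" R by (intro ideal_power_is_ideal I)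
  interpret J: ideal ?J R by (intro ideal_power_is_ideal I)
  interpret Q: abelian_monoid "R Quot ?J"
    by (intro abelian_monoid_Quot ideal_power_is_ideal I)
  have carr: "?J +> z \<in> carrier (R Quot ?J)" if "z \<in> ?P n" for z
    using P.Icarr[OF that] by (simp add: FactRing_def a_rcosetsI J.a_subset)
  have F: "\<exists>a\<in>?P n. ?F i = ?J +> a" if "i \<le> n" for i
  proof -
    from f g obtain a c where a: "a \<in> ?P i" "f i = ?P (Suc i) +> a"
      and c: "c \<in> ?P (n - i)" "g (n - i) = ?P (Suc (n - i)) +> c"
      unfolding coset_sequences_def by blast
    have "i + (n - i) = n" using that by simp
    then have "?F i = ?J +> a \<otimes> c" "a \<otimes> c \<in> ?P n"
      using rcoset_mult_ideal_power[OF I a(1) c(1)] ideal_power_mult_closed[OF I a(1) c(1)] a(2) c(2)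
      by simp_all
    then show ?thesis by blast
  qed
  \<comment> \<open>The sum is treated by induction over finite subsets of \<open>{..n}\<close>: the
    empty sum is the coset of zero, and representatives in I^n add up within I^n.\<close>
  have "\<exists>a\<in>?P n. (\<Oplus>\<^bsub>R Quot ?J\<^esub>i\<in>A. ?F i) = ?J +> a" if "finite A" "A \<subseteq> {..n}" for A
    using that
  proof (induction A rule: finite_induct)
    case empty
    have "(\<Oplus>\<^bsub>R Quot ?J\<^esub>i\<in>{}. ?F i) = ?J"
      using Q.finsum_empty[of ?F] by (simp add: FactRing_def)
    also have "\<dots> = ?J +> \<zero>"
      using ideal_coset_eq_iff[OF J.ideal_axioms zero_closed] J.zero_closed by blast
    finally show ?case
      using P.zero_closed by blast
  next
    case (insert i A)
    then obtain a where a: "a \<in> ?P n" "(\<Oplus>\<^bsub>R Quot ?J\<^esub>i\<in>A. ?F i) = ?J +> a" by auto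
    obtain c where c: "c \<in> ?P n" "?F i = ?J +> c"
      using F[of i] insert.prems by auto
    have "?F x \<in> carrier (R Quot ?J)" if "x \<in> insert i A" for x
    proof -
      obtain a where "a \<in> ?P n" "?F x = ?J +> a"
        using F[of x] insert.prems \<open>x \<in> insert i A\<close> by auto
      then show ?thesis using carr by simp
    qed
    then have "(\<Oplus>\<^bsub>R Quot ?J\<^esub>i\<in>insert i A. ?F i) = ?F i \<oplus>\<^bsub>R Quot ?J\<^esub> (\<Oplus>\<^bsub>R Quot ?J\<^esub>i\<in>A. ?F i)"
      using insert.hyps by (intro Q.finsum_insert) blast+
    also have "\<dots> = ?J +> (c \<oplus> a)"
      using a c P.Icarr J.a_rcos_sum by (simp add: FactRing_def)
    finally show ?case
      using P.a_closed[OF c(1) a(1)] by blast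
  qed
  from this[of "{..n}"] show "\<exists>a\<in>?P n. (f \<otimes>\<^bsub>assoc_graded R I\<^esub> g) n = ?J +> a"
    unfolding assoc_graded_mult_component by simp
qed

lemma coset_sequences_add_closed:
  assumes I: "ideal I R" and f: "f \<in> coset_sequences R I" and g: "g \<in> coset_sequences R I"
  shows "f \<oplus>\<^bsub>assoc_graded R I\<^esub> g \<in> coset_sequences R I"
  unfolding coset_sequences_def
proof (intro CollectI allI)
  fix n
  interpret P: ideal "ideal_power R I n" R by (intro ideal_power_is_ideal I)
  interpret J: ideal "ideal_power R I (Suc n)" R by (intro ideal_power_is_ideal I)
  from f g obtain a c where "a \<in> ideal_power R I n" "f n = ideal_power R I (Suc n) +> a"
    and "c \<in> ideal_power R I n" "g n = ideal_power R I (Suc n) +> c"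
    unfolding coset_sequences_def by blast
  then show "\<exists>a\<in>ideal_power R I n. (f \<oplus>\<^bsub>assoc_graded R I\<^esub> g) n = ideal_power R I (Suc n) +> a"
    using P.Icarr J.a_rcos_sum P.a_closed unfolding assoc_graded_add_component by metis
qed

text \<open>By induction on k: for a factor that vanishes in degree 0 and one that vanishes below
  degree k, each term of the product in degree n <= k has i = 0 or n - i < k, hence a vanishing
  factor.\<close>

lemma homogeneous_max_ideal_power:
  assumes I: "ideal I R"
    and "f \<in> ideal_power (assoc_graded R I) (homogeneous_max_ideal R I) k"
  shows "f \<in> coset_sequences R I \<and> (\<forall>i<k. f i = ideal_power R I (Suc i))"
  using assms(2)
proof (induction k arbitrary: f)
  case 0
  then show ?case by (simp add: carrier_assoc_graded)
next
  case (Suc k)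
  let ?G = "assoc_graded R I" and ?N = "homogeneous_max_ideal R I"
  from Suc.prems have "f \<in> ideal_prod ?G ?N (ideal_power ?G ?N k)"
    by (simp add: ideal_power.simps(2))
  then show ?case
  proof induction
    case (prod f g)
    then have f: "f \<in> coset_sequences R I" "f 0 = ideal_power R I (Suc 0)"
      by (auto simp: homogeneous_max_ideal_def carrier_assoc_graded)
    have g: "g \<in> coset_sequences R I" "\<And>i. i < k \<Longrightarrow> g i = ideal_power R I (Suc i)"
      using Suc.IH prod by auto
    have "(f \<otimes>\<^bsub>?G\<^esub> g) n = ideal_power R I (Suc n)" if "n < Suc k" for n
    proof (rule assoc_graded_mult_zero[OF _ I])
      fix i assume "i \<le> n"
      show "rcoset_mult R (ideal_power R I (Suc n)) (f i) (g (n - i)) = ideal_power R I (Suc n)"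
      proof (rule rcoset_mult_zero[OF I \<open>i \<le> n\<close> f(1) g(1)])
        show "f i = ideal_power R I (Suc i) \<or> g (n - i) = ideal_power R I (Suc (n - i))"
          using f(2) g(2)[of "n - i"] that \<open>i \<le> n\<close> by (cases "i = 0") auto
      qed
    qed
    then show ?case
      using coset_sequences_mult_closed[OF I f(1) g(1)] by blast
  next
    case (sum f g)
    have "ideal_power R I (Suc n) <+> ideal_power R I (Suc n) = ideal_power R I (Suc n)" for n
    proof -
      interpret J: ideal "ideal_power R I (Suc n)" R by (intro ideal_power_is_ideal I)
      show ?thesis
        using J.a_rcos_sum[OF zero_closed zero_closed] ideal_coset_eq_iff[OF J.ideal_axioms zero_closed]
          J.zero_closed by simp
    qed
    then have "\<forall>i<Suc k. (f \<oplus>\<^bsub>?G\<^esub> g) i = ideal_power R I (Suc i)"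
      using sum.IH by (simp add: assoc_graded_add_component)
    then show ?case
      using sum.IH coset_sequences_add_closed[OF I, of f g] by blast
  qed
qed

section \<open>Torsion classes and the Buchsbaum condition\<close>

lemma initial_form_in_carrier:
  assumes I: "ideal I R" and a: "a \<in> ideal_power R I n"
  shows "initial_form R I n a \<in> carrier (assoc_graded R I)"
proof -
  have "\<exists>c\<in>ideal_power R I i. initial_form R I n a i = ideal_power R I (Suc i) +> c" for i
  proof (cases "i = n")
    case True
    then show ?thesis using a by (auto simp: initial_form_def)
  next
    case False
    interpret P: ideal "ideal_power R I i" R by (intro ideal_power_is_ideal I)
    interpret J: ideal "ideal_power R I (Suc i)" R by (intro ideal_power_is_ideal I)
    show ?thesis
      using ideal_coset_eq_iff[OF J.ideal_axioms zero_closed] J.zero_closed P.zero_closed False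
      by (metis initial_form_def)
  qed
  moreover have "finite {i. initial_form R I n a i \<noteq> ideal_power R I (Suc i)}"
    by (rule finite_subset[of _ "{n}"]) (auto simp: initial_form_def)
  ultimately show ?thesis
    by (simp add: carrier_assoc_graded coset_sequences_def)
qed

text \<open>Elements of \<open>?N\<close> to the power k+1 vanish in degrees up to k, and
  \<open>ann\<close> kills the products with their components of higher degree. The exponent k+1 is
  positive, as \<open>local_cohomology_0\<close> demands, even for k = 0.\<close>

lemma initial_form_in_local_cohomology_0:
  assumes I: "ideal I R" and a: "a \<in> ideal_power R I b"
    and ann: "\<And>j z. k \<le> j \<Longrightarrow> z \<in> ideal_power R I j \<Longrightarrow> a \<otimes> z \<in> ideal_power R I (Suc (b + j))"
  shows "initial_form R I b a \<in> local_cohomology_0 (assoc_graded R I) (homogeneous_max_ideal R I)"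
proof -
  let ?G = "assoc_graded R I" and ?N = "homogeneous_max_ideal R I" and ?f = "initial_form R I b a"
  have f: "?f \<in> carrier ?G" by (rule initial_form_in_carrier[OF I a])
  have "?f \<otimes>\<^bsub>?G\<^esub> g = \<zero>\<^bsub>?G\<^esub>" if "g \<in> ideal_power ?G ?N (Suc k)" for g
  proof
    fix n
    have g: "g \<in> coset_sequences R I" "\<And>i. i < Suc k \<Longrightarrow> g i = ideal_power R I (Suc i)"
      using homogeneous_max_ideal_power[OF I that] by auto
    have "(?f \<otimes>\<^bsub>?G\<^esub> g) n = ideal_power R I (Suc n)"
    proof (rule assoc_graded_mult_zero[OF _ I])
      fix i assume "i \<le> n"
      show "rcoset_mult R (ideal_power R I (Suc n)) (?f i) (g (n - i)) = ideal_power R I (Suc n)"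
      proof (cases "i = b \<and> k \<le> n - i")
        case True
        from g(1) obtain z where z: "z \<in> ideal_power R I (n - b)"
          "g (n - b) = ideal_power R I (Suc (n - b)) +> z"
          unfolding coset_sequences_def by blast
        have n: "b + (n - b) = n" using True \<open>i \<le> n\<close> by simp
        have az: "a \<otimes> z \<in> ideal_power R I (Suc n)"
          using ann[OF _ z(1)] True n by metis
        have "rcoset_mult R (ideal_power R I (Suc n)) (?f b) (g (n - b)) = ideal_power R I (Suc n) +> a \<otimes> z"
          using rcoset_mult_ideal_power[OF I a z(1)] n z(2)
          by (simp add: initial_form_def)
        also have "\<dots> = ideal_power R I (Suc n)"
          using ideal_coset_eq_iff[OF ideal_power_is_ideal[OF I]] az
            ideal.Icarr[OF ideal_power_is_ideal[OF I] az] by blast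
        finally show ?thesis using True by simp
      next
        case False
        then have "?f i = ideal_power R I (Suc i) \<or> g (n - i) = ideal_power R I (Suc (n - i))"
          using g(2)[of "n - i"] by (auto simp: initial_form_def)
        then show ?thesis
          using rcoset_mult_zero[OF I \<open>i \<le> n\<close> _ g(1)] f carrier_assoc_graded by blast
      qed
    qed
    then show "(?f \<otimes>\<^bsub>?G\<^esub> g) n = \<zero>\<^bsub>?G\<^esub> n"
      by (simp add: assoc_graded_def)
  qed
  then have "?f \<in> annihilator ?G (ideal_power ?G ?N (Suc k))"
    using f by (simp add: annihilator_def)
  then show ?thesis
    unfolding local_cohomology_0_def by (intro UN_I[of "Suc k"]) auto
qed

text \<open>The class of \<open>a\<close> in degree b is torsion, so the class of \<open>c\<close>
  in degree 1 annihilates it. The component of this product in degree b+1 is the coset of ca modulo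
  I^(b+2), and its vanishing is the claim.\<close>

lemma graded_buchsbaum_mult_mem:
  assumes I: "ideal I R" and buchsbaum: "graded_buchsbaum R I"
    and a: "a \<in> ideal_power R I b"
    and ann: "\<And>j z. k \<le> j \<Longrightarrow> z \<in> ideal_power R I j \<Longrightarrow> a \<otimes> z \<in> ideal_power R I (Suc (b + j))"
    and c: "c \<in> I"
  shows "c \<otimes> a \<in> ideal_power R I (Suc (Suc b))"
proof -
  let ?G = "assoc_graded R I" and ?N = "homogeneous_max_ideal R I"
  let ?f = "initial_form R I b a" and ?g = "initial_form R I 1 c"
  have ca: "c \<in> carrier R" "a \<in> carrier R"
    using c a ideal.Icarr[OF I] ideal.Icarr[OF ideal_power_is_ideal[OF I]] by auto
  \<comment> \<open>\<open>ideal_power R I 1\<close> is by definition the product of I with the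
    whole ring, so \<open>c\<close> is read as c times one.\<close>
  have c1: "c \<in> ideal_power R I 1"
    using ca ideal_prod.prod[OF c one_closed, of R] by (simp add: ideal_power.simps(2))
  have g: "?g \<in> carrier ?G" and f: "?f \<in> carrier ?G"
    using initial_form_in_carrier[OF I] c1 a by auto
  have "?g \<in> ?N"
    using g by (simp add: homogeneous_max_ideal_def initial_form_def)
  then have "?g \<otimes>\<^bsub>?G\<^esub> ?f \<in> ideal_prod ?G ?N (local_cohomology_0 ?G ?N)"
    using initial_form_in_local_cohomology_0[OF I a ann] by (intro ideal_prod.prod)
  then have "?g \<otimes>\<^bsub>?G\<^esub> ?f = \<zero>\<^bsub>?G\<^esub>"
    using buchsbaum by (simp add: graded_buchsbaum_def Let_def)
  then have "(?g \<otimes>\<^bsub>?G\<^esub> ?f) (Suc b) = ideal_power R I (Suc (Suc b))"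
    by (simp add: assoc_graded_def)
  moreover have "(?g \<otimes>\<^bsub>?G\<^esub> ?f) (Suc b) = ideal_power R I (Suc (Suc b)) +> c \<otimes> a"
  proof (rule assoc_graded_mult_single[OF I])
    fix i assume i: "i \<le> Suc b" "i \<noteq> 1"
    show "rcoset_mult R (ideal_power R I (Suc (Suc b))) (?g i) (?f (Suc b - i)) = ideal_power R I (Suc (Suc b))"
    proof (rule rcoset_mult_zero[OF I i(1)])
      show "?g i = ideal_power R I (Suc i) \<or> ?f (Suc b - i) = ideal_power R I (Suc (Suc b - i))"
        using i by (simp add: initial_form_def)
    qed (use f g in \<open>auto simp: carrier_assoc_graded\<close>)
  next
    show "rcoset_mult R (ideal_power R I (Suc (Suc b))) (?g 1) (?f (Suc b - 1))
      = ideal_power R I (Suc (Suc b)) +> c \<otimes> a"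
      using rcoset_mult_ideal_power[OF I c1 a] by (simp add: initial_form_def)
  qed (use ca in auto)
  ultimately show ?thesis
    using ideal_coset_eq_iff[OF ideal_power_is_ideal[OF I]] ca by blast
qed

end

section \<open>Powers of the maximal ideal of a semigroup ring\<close>

text \<open>Prescribing a lower bound for the length makes these sets decrease in n and makes the
  case n = 0 the whole semigroup, in agreement with the convention 0M = S.\<close>

definition long_sums :: "nat set \<Rightarrow> nat \<Rightarrow> nat set" where
  "long_sums A n = {sum_list xs | xs. set xs \<subseteq> A \<and> n \<le> length xs}"

lemma long_sumsI: "set xs \<subseteq> A \<Longrightarrow> n \<le> length xs \<Longrightarrow> sum_list xs \<in> long_sums A n"
  unfolding long_sums_def by blast

lemma long_sums_antimono: "m \<le> n \<Longrightarrow> long_sums A n \<subseteq> long_sums A m"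
  unfolding long_sums_def by fastforce

lemma long_sums_add:
  assumes "s \<in> long_sums A m" "t \<in> long_sums A n"
  shows "s + t \<in> long_sums A (m + n)"
proof -
  from assms obtain xs ys where "set xs \<subseteq> A" "m \<le> length xs" "s = sum_list xs"
    and "set ys \<subseteq> A" "n \<le> length ys" "t = sum_list ys"
    unfolding long_sums_def by blast
  then show ?thesis
    using long_sumsI[of "xs @ ys" A "m + n"] by simp
qed

lemma generator_in_long_sums: "a \<in> A \<Longrightarrow> a \<in> long_sums A (Suc 0)"
  using long_sumsI[of "[a]" A "Suc 0"] by simp

lemma long_sums_SucE:
  assumes "s \<in> long_sums A (Suc n)"
  obtains a t where "a \<in> A" "t \<in> long_sums A n" "s = a + t"
proof -
  from assms obtain xs where xs: "set xs \<subseteq> A" "Suc n \<le> length xs" "s = sum_list xs"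
    unfolding long_sums_def by blast
  then obtain a ys where "xs = a # ys" by (cases xs) auto
  with xs that[of a "sum_list ys"] long_sumsI[of ys A n] show ?thesis by simp
qed

lemma long_sums_0: "long_sums A 0 = semigroup_gen A"
proof (intro equalityI subsetI)
  fix s assume "s \<in> long_sums A 0"
  then obtain xs where "set xs \<subseteq> A" "s = sum_list xs"
    unfolding long_sums_def by blast
  then show "s \<in> semigroup_gen A"
    by (induction xs arbitrary: s) (auto intro: semigroup_gen.intros)
next
  fix s assume "s \<in> semigroup_gen A"
  then show "s \<in> long_sums A 0"
  proof induction
    case zero
    show ?case using long_sumsI[of "[]" A 0] by simp
  next
    case (add a s)
    then show ?case
      using long_sums_add[OF generator_in_long_sums] long_sums_antimono[of 0 "Suc 0" A] by fastforce
  qed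
qed

lemma long_sums_subset_semigroup_gen: "long_sums A n \<subseteq> semigroup_gen A"
  using long_sums_antimono[of 0 n A] by (simp add: long_sums_0)

text \<open>A nonzero element of the semigroup is a sum of at least one generator, so n such
  elements give at least n generators. Conversely, generators can be grouped into exactly n
  summands, which are nonzero because 0 is not a generator.\<close>

lemma max_ideal_multiple_eq_long_sums:
  assumes "0 \<notin> A"
  shows "max_ideal_multiple (semigroup_gen A) n = long_sums A n"
proof (cases n)
  case 0
  then show ?thesis by (simp add: max_ideal_multiple_def long_sums_0)
next
  case (Suc m)
  let ?M = "semigroup_gen A - {0}"
  have pos: "s \<noteq> 0" if "s \<in> long_sums A (Suc k)" for s k
    using long_sums_SucE[OF that] assms by (metis add_is_0)
  have "sum_list xs \<in> long_sums A (length xs)" if "set xs \<subseteq> ?M" for xs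
    using that
  proof (induction xs)
    case Nil
    then show ?case by (simp add: long_sums_0 semigroup_gen.zero)
  next
    case (Cons x xs)
    from Cons.prems obtain ys where ys: "set ys \<subseteq> A" "x = sum_list ys"
      unfolding long_sums_0[symmetric] long_sums_def by auto
    moreover have "ys \<noteq> []" using ys Cons.prems by auto
    ultimately have "x \<in> long_sums A (Suc 0)"
      using long_sumsI[of ys A "Suc 0"] by (cases ys) auto
    then show ?case
      using long_sums_add[of x A "Suc 0" "sum_list xs" "length xs"] Cons by simp
  qed
  \<comment> \<open>Generators are split off one at a time; the last summand collects all that
    remain.\<close>
  moreover have "\<exists>xs. length xs = Suc k \<and> set xs \<subseteq> ?M \<and> s = sum_list xs"
    if "s \<in> long_sums A (Suc k)" for s k
    using that
  proof (induction k arbitrary: s)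
    case 0
    then have "s \<in> ?M" using pos long_sums_subset_semigroup_gen by blast
    then show ?case by (intro exI[of _ "[s]"]) simp
  next
    case (Suc k)
    from Suc.prems obtain a t where a: "a \<in> A" "t \<in> long_sums A (Suc k)" "s = a + t"
      by (rule long_sums_SucE)
    from Suc.IH[OF a(2)] obtain xs where "length xs = Suc k" "set xs \<subseteq> ?M" "t = sum_list xs" by blast
    moreover have "a \<in> ?M"
      using generator_in_long_sums[OF a(1)] pos long_sums_subset_semigroup_gen by blast
    ultimately show ?case
      using a(3) by (intro exI[of _ "a # xs"]) simp
  qed
  ultimately show ?thesis
    using Suc unfolding max_ideal_multiple_def by fastforce
qed

section \<open>Monomials in the powers of the maximal ideal\<close>

lemma (in cring) cring_idealI:
  assumes "J \<subseteq> carrier R" "\<zero> \<in> J"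
    and "\<And>x y. x \<in> J \<Longrightarrow> y \<in> J \<Longrightarrow> x \<oplus> y \<in> J"
    and "\<And>r x. r \<in> carrier R \<Longrightarrow> x \<in> J \<Longrightarrow> r \<otimes> x \<in> J"
  shows "ideal J R"
proof (rule idealI)
  show "subgroup J (add_monoid R)"
  proof (rule add.subgroupI)
    show "\<ominus> x \<in> J" if "x \<in> J" for x
      using assms(4)[of "\<ominus> \<one>" x] assms(1) that by (auto simp: l_minus)
  qed (use assms in auto)
  show "x \<otimes> r \<in> J" if "x \<in> J" "r \<in> carrier R" for x r
    using assms(1,4) that m_comm by (metis subsetD)
qed (use assms ring_axioms in auto)

lemma semigroup_ring_simps:
  "carrier (semigroup_ring S) = {f. \<forall>n. fps_nth f n \<noteq> 0 \<longrightarrow> n \<in> S}"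
  "f \<otimes>\<^bsub>semigroup_ring S\<^esub> g = f * g" "f \<oplus>\<^bsub>semigroup_ring S\<^esub> g = f + g"
  "\<one>\<^bsub>semigroup_ring S\<^esub> = 1" "\<zero>\<^bsub>semigroup_ring S\<^esub> = 0"
  by (simp_all add: semigroup_ring_def)

lemma fps_mult_support:
  fixes f g :: "'k::field fps"
  assumes "fps_nth (f * g) n \<noteq> 0"
  obtains i j where "fps_nth f i \<noteq> 0" "fps_nth g j \<noteq> 0" "n = i + j"
proof -
  from assms obtain i where "i \<le> n" "fps_nth f i * fps_nth g (n - i) \<noteq> 0"
    unfolding fps_mult_nth by (metis (no_types, lifting) atLeastAtMost_iff sum.neutral)
  then show ?thesis using that[of i "n - i"] by auto
qed

context
  fixes A :: "nat set" and R :: "'k::field fps ring" and I :: "'k fps set"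
  defines "R \<equiv> semigroup_ring (semigroup_gen A)"
    and "I \<equiv> semigroup_max_ideal (semigroup_gen A) A"
begin

interpretation R: cring R
  unfolding R_def by (rule cring_semigroup_ring)

lemma monomial_in_carrier: "s \<in> semigroup_gen A \<Longrightarrow> fps_X ^ s \<in> carrier R"
  by (simp add: R_def semigroup_ring_simps)

lemma generators_in_carrier: "(\<lambda>g. fps_X ^ g) ` A \<subseteq> carrier R"
  using monomial_in_carrier generator_in_long_sums long_sums_subset_semigroup_gen by blast

lemma semigroup_max_ideal_is_ideal: "ideal I R"
  unfolding I_def semigroup_max_ideal_def R_def[symmetric]
  by (rule R.genideal_ideal[OF generators_in_carrier])

lemma generator_in_max_ideal: "g \<in> A \<Longrightarrow> fps_X ^ g \<in> I"
  unfolding I_def semigroup_max_ideal_def R_def[symmetric]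
  using R.genideal_self[OF generators_in_carrier] by blast

text \<open>Let \<open>?V n\<close> be the series supported in \<open>long_sums A n\<close>.
  Supports add under multiplication, so the product of \<open>?V m\<close> and \<open>?V n\<close>
  lies in \<open>?V (m + n)\<close>. As \<open>?V 1\<close> is an ideal that contains the
  generators, it contains I, and induction puts I^n into \<open>?V n\<close>.\<close>

lemma ideal_power_support:
  assumes "f \<in> ideal_power R I n" "fps_nth f k \<noteq> 0"
  shows "k \<in> long_sums A n"
proof -
  let ?V = "\<lambda>n. {f :: 'k fps. \<forall>k. fps_nth f k \<noteq> 0 \<longrightarrow> k \<in> long_sums A n}"
  have mult: "f * g \<in> ?V (m + n)" if "f \<in> ?V m" "g \<in> ?V n" for f g m n
    using that by (auto elim!: fps_mult_support intro: long_sums_add)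
  have carr: "carrier R = ?V 0"
    by (simp add: R_def semigroup_ring_simps long_sums_0)
  have "ideal (?V (Suc 0)) R"
  proof (rule R.cring_idealI)
    show "?V (Suc 0) \<subseteq> carrier R"
      unfolding carr using long_sums_antimono[of 0 "Suc 0" A] by blast
    show "f \<oplus>\<^bsub>R\<^esub> g \<in> ?V (Suc 0)" if "f \<in> ?V (Suc 0)" "g \<in> ?V (Suc 0)" for f g
    proof -
      have "fps_nth (f + g) k = 0" if "fps_nth f k = 0" "fps_nth g k = 0" for k
        using that by simp
      then show ?thesis
        using that unfolding R_def semigroup_ring_simps by blast
    qed
    show "f \<otimes>\<^bsub>R\<^esub> g \<in> ?V (Suc 0)" if "f \<in> carrier R" "g \<in> ?V (Suc 0)" for f g
      using mult[of f 0 g "Suc 0"] that unfolding carr by (simp add: R_def semigroup_ring_simps)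
  qed (simp add: R_def semigroup_ring_simps)
  moreover have "(\<lambda>g. fps_X ^ g) ` A \<subseteq> ?V (Suc 0)"
    using generator_in_long_sums by (auto split: if_splits)
  ultimately have I: "I \<subseteq> ?V (Suc 0)"
    unfolding I_def semigroup_max_ideal_def R_def[symmetric] by (rule R.genideal_minimal)
  have "ideal_power R I n \<subseteq> ?V n" for n
  proof (induction n)
    case 0
    then show ?case using carr by simp
  next
    case (Suc n)
    show ?case
    proof
      fix f assume "f \<in> ideal_power R I (Suc n)"
      then have "f \<in> ideal_prod R I (ideal_power R I n)" by (simp add: ideal_power.simps(2))
      then show "f \<in> ?V (Suc n)"
      proof induction
        case (prod f g)
        then show ?case
          using mult[of f "Suc 0" g n] I Suc.IH by (auto simp: R_def semigroup_ring_simps)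
      next
        case (sum f g)
        have "fps_nth (f + g) k = 0" if "fps_nth f k = 0" "fps_nth g k = 0" for k
          using that by simp
        then show ?case
          using sum.IH unfolding R_def semigroup_ring_simps by blast
      qed
    qed
  qed
  then show ?thesis using assms by blast
qed

lemma monomial_in_ideal_power:
  "fps_X ^ s \<in> ideal_power R I n \<longleftrightarrow> s \<in> long_sums A n"
proof
  assume "fps_X ^ s \<in> ideal_power R I n"
  then show "s \<in> long_sums A n" by (rule ideal_power_support) simp
next
  assume "s \<in> long_sums A n"
  then show "fps_X ^ s \<in> ideal_power R I n"
  proof (induction n arbitrary: s)
    case 0
    then show ?case by (simp add: monomial_in_carrier long_sums_0)
  next
    case (Suc n)
    from Suc.prems obtain a t where a: "a \<in> A" "t \<in> long_sums A n" "s = a + t"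
      by (rule long_sums_SucE)
    have "fps_X ^ a \<otimes>\<^bsub>R\<^esub> fps_X ^ t \<in> ideal_prod R I (ideal_power R I n)"
      using generator_in_max_ideal[OF a(1)] Suc.IH[OF a(2)] by (rule ideal_prod.prod)
    then show ?case
      using a(3) by (simp add: ideal_power.simps(2) R_def semigroup_ring_simps power_add)
  qed
qed

text \<open>This reduces annihilation of all of I^j to the products of j generators. An ideal
  quotient of J replaces the expansion of elements of I^j into combinations of such
  products.\<close>

lemma monomial_mult_ideal_power:
  assumes J: "ideal J R" and s: "s \<in> semigroup_gen A"
    and sums: "\<And>xs. set xs \<subseteq> A \<Longrightarrow> length xs = j \<Longrightarrow> fps_X ^ (s + sum_list xs) \<in> J"
    and f: "f \<in> ideal_power R I j"
  shows "fps_X ^ s \<otimes>\<^bsub>R\<^esub> f \<in> J"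
  using s sums f
proof (induction j arbitrary: s f)
  case 0
  then have "fps_X ^ s \<in> J" using "0.prems"(2)[of "[]"] by simp
  then show ?case using "0.prems" J by (simp add: ideal.I_r_closed)
next
  case (Suc j)
  interpret J: ideal J R by fact
  note carr = ideal.Icarr[OF R.ideal_power_is_ideal[OF semigroup_max_ideal_is_ideal]]
    ideal.Icarr[OF semigroup_max_ideal_is_ideal]
  have s: "fps_X ^ s \<in> carrier R" using Suc.prems(1) by (rule monomial_in_carrier)
  have "f \<in> ideal_prod R I (ideal_power R I j)"
    using Suc.prems by (simp add: ideal_power.simps(2))
  then show ?case
  proof induction
    case (prod x y)
    \<comment> \<open>For fixed y this is an ideal, so it contains I as soon as it contains the
      generators of I. For a generator \<open>fps_X ^ g\<close>, the induction hypothesis applies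
      with s + g in place of s.\<close>
    let ?K = "{x \<in> carrier R. fps_X ^ s \<otimes>\<^bsub>R\<^esub> (x \<otimes>\<^bsub>R\<^esub> y) \<in> J}"
    have y: "y \<in> carrier R" using carr prod by blast
    have "ideal ?K R"
    proof (rule R.cring_idealI)
      show "\<zero>\<^bsub>R\<^esub> \<in> ?K" using s y J.zero_closed by simp
      show "u \<oplus>\<^bsub>R\<^esub> v \<in> ?K" if "u \<in> ?K" "v \<in> ?K" for u v
        using that s y J.a_closed by (simp add: R.l_distr R.r_distr)
      show "r \<otimes>\<^bsub>R\<^esub> u \<in> ?K" if "r \<in> carrier R" "u \<in> ?K" for r u
      proof -
        have "fps_X ^ s \<otimes>\<^bsub>R\<^esub> ((r \<otimes>\<^bsub>R\<^esub> u) \<otimes>\<^bsub>R\<^esub> y) = r \<otimes>\<^bsub>R\<^esub> (fps_X ^ s \<otimes>\<^bsub>R\<^esub> (u \<otimes>\<^bsub>R\<^esub> y))"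
          using that s y by (simp add: R.m_ac)
        then show ?thesis using that J.I_l_closed by simp
      qed
    qed auto
    moreover have "fps_X ^ g \<in> ?K" if "g \<in> A" for g
    proof -
      have "s + g \<in> semigroup_gen A"
        using Suc.prems(1) \<open>g \<in> A\<close> semigroup_gen.add[of g A s] by (simp add: add.commute)
      moreover have "fps_X ^ (s + g + sum_list xs) \<in> J" if "set xs \<subseteq> A" "length xs = j" for xs
        using Suc.prems(2)[of "g # xs"] that \<open>g \<in> A\<close> by (simp add: add.assoc)
      ultimately have "fps_X ^ (s + g) \<otimes>\<^bsub>R\<^esub> y \<in> J"
        using Suc.IH prod by blast
      then show ?thesis
        using generators_in_carrier that
        by (auto simp: R_def semigroup_ring_simps power_add mult.assoc)
    qed
    ultimately have "I \<subseteq> ?K"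
      unfolding I_def semigroup_max_ideal_def R_def[symmetric]
      by (intro R.genideal_minimal) auto
    then show ?case using prod by blast
  next
    case (sum x y)
    have "x \<in> carrier R" "y \<in> carrier R"
      using sum.hyps carr(1)[of _ "Suc j"] by (auto simp: ideal_power.simps(2))
    then show ?case using sum.IH s J.a_closed by (simp add: R.r_distr)
  qed
qed

text \<open>The Buchsbaum condition read off on exponents: \<open>sums\<close> says that products of
  at least k generators annihilate the class of \<open>fps_X ^ s\<close> in degree b, so the class
  of each generator must annihilate it too.\<close>

lemma graded_buchsbaum_long_sums:
  assumes "graded_buchsbaum R I" "s \<in> long_sums A b" "g \<in> A"
    and sums: "\<And>xs. set xs \<subseteq> A \<Longrightarrow> k \<le> length xs \<Longrightarrow>
      s + sum_list xs \<in> long_sums A (Suc (b + length xs))"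
  shows "s + g \<in> long_sums A (Suc (Suc b))"
proof -
  have "fps_X ^ g \<otimes>\<^bsub>R\<^esub> fps_X ^ s \<in> ideal_power R I (Suc (Suc b))"
  proof (rule R.graded_buchsbaum_mult_mem[where k = k])
    fix j z assume j: "k \<le> j" and z: "z \<in> ideal_power R I j"
    show "fps_X ^ s \<otimes>\<^bsub>R\<^esub> z \<in> ideal_power R I (Suc (b + j))"
    proof (rule monomial_mult_ideal_power[OF _ _ _ z])
      show "ideal (ideal_power R I (Suc (b + j))) R"
        by (rule R.ideal_power_is_ideal[OF semigroup_max_ideal_is_ideal])
      show "s \<in> semigroup_gen A" using assms(2) long_sums_subset_semigroup_gen by blast
    qed (use sums j in \<open>auto simp: monomial_in_ideal_power\<close>)
  qed (use assms semigroup_max_ideal_is_ideal generator_in_max_ideal in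
      \<open>auto simp: monomial_in_ideal_power\<close>)
  also have "fps_X ^ g \<otimes>\<^bsub>R\<^esub> fps_X ^ s = (fps_X ^ (s + g) :: 'k fps)"
    by (simp add: R_def semigroup_ring_simps power_add mult.commute)
  finally show ?thesis by (simp add: monomial_in_ideal_power)
qed

end

section \<open>Orders and Apery sets\<close>

text \<open>Removing 0 from a set of generators does not change the generated semigroup, which would
  contradict minimality.\<close>

lemma zero_notin_minimal_generators:
  assumes "minimal_generators A S"
  shows "0 \<notin> A"
proof
  assume "0 \<in> A"
  have "s \<in> semigroup_gen (A - {0})" if "s \<in> semigroup_gen A" for s
    using that
  proof induction
    case (add a s)
    then show ?case by (cases "a = 0") (auto intro: semigroup_gen.add)
  qed (rule semigroup_gen.zero)
  moreover have "s \<in> semigroup_gen A" if "s \<in> semigroup_gen (A - {0})" for s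
    using that by induction (auto intro: semigroup_gen.intros)
  ultimately have "semigroup_gen (A - {0}) = S"
    using assms by (auto simp: minimal_generators_def)
  moreover have "A - {0} \<subset> A" using \<open>0 \<in> A\<close> by blast
  ultimately show False using assms unfolding minimal_generators_def by blast
qed

lemma long_sums_length_le:
  assumes "0 \<notin> A" "s \<in> long_sums A n"
  shows "n \<le> s"
  using assms(2)
proof (induction n arbitrary: s)
  case (Suc n)
  from Suc.prems obtain a t where "a \<in> A" "t \<in> long_sums A n" "s = a + t"
    by (rule long_sums_SucE)
  then show ?case
    using Suc.IH[of t] assms(1) by (cases "a = 0") auto
qed simp

text \<open>The maximum is attained: the set of lengths contains 0, and it is bounded by s because
  all generators are positive.\<close>

lemma adic_order:
  assumes "0 \<notin> A" "s \<in> semigroup_gen A"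
  shows "s \<in> long_sums A (adic_order (semigroup_gen A) s)"
    and "s \<in> long_sums A n \<Longrightarrow> n \<le> adic_order (semigroup_gen A) s"
proof -
  let ?L = "{l. s \<in> long_sums A l}"
  have fin: "finite ?L"
    by (rule finite_subset[of _ "{..s}"]) (use long_sums_length_le[OF assms(1)] in auto)
  have eq: "adic_order (semigroup_gen A) s = Max ?L"
    by (simp add: adic_order_def max_ideal_multiple_eq_long_sums[OF assms(1)])
  have "0 \<in> ?L" using assms(2) by (simp add: long_sums_0)
  then show "s \<in> long_sums A (adic_order (semigroup_gen A) s)"
    unfolding eq using Max_in[OF fin] by blast
  show "n \<le> adic_order (semigroup_gen A) s" if "s \<in> long_sums A n"
    unfolding eq using fin that by simp
qed

section \<open>Apery elements and residue classes\<close>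

lemma apery:
  assumes "s \<in> S" "s mod g = i mod g"
  shows "apery S g i \<in> S" "apery S g i mod g = i mod g" "apery S g i \<le> s"
  using LeastI[of "\<lambda>s. s \<in> S \<and> s mod g = i mod g" s] assms
    Least_le[of "\<lambda>s. s \<in> S \<and> s mod g = i mod g" s]
  by (auto simp: apery_def)

text \<open>Both Apery elements are congruent to i, so their difference is a multiple of g;
  positivity of g makes the quotient unique. The witnesses s and s' ensure that the least elements
  exist.\<close>

lemma apery_a_eq:
  assumes "0 < g" "s \<in> S" "s mod g = i mod g" "s' \<in> S'" "s' mod g = i mod g"
  shows "int (apery S' g i) + apery_a S S' g i * int g = int (apery S g i)"
proof -
  have "int (apery S g i) mod int g = int (apery S' g i) mod int g"
    using apery(2)[of s S g i] apery(2)[of s' S' g i] assms by (simp flip: zmod_int)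
  then obtain a where a: "int (apery S g i) = int (apery S' g i) + int g * a"
    by (metis add.commute diff_add_cancel dvdE mod_eq_dvd_iff)
  show ?thesis
    unfolding apery_a_def
    by (rule theI[where a = a]) (use a \<open>0 < g\<close> in \<open>auto simp: algebra_simps\<close>)
qed

lemma semigroup_gen_residues:
  assumes "Gcd {g1, g2, g3 :: nat} = 1" "0 < g1"
  shows "\<exists>s \<in> semigroup_gen {g1, g2, g3}. s mod g1 = i mod g1"
proof -
  let ?A = "{g1, g2, g3}"
  have mult: "n * a \<in> semigroup_gen ?A" if "a \<in> ?A" for n a
    using that by (induction n) (auto intro: semigroup_gen.intros)
  have "gcd (int g1) (gcd (int g2) (int g3)) = 1"
    using assms(1) by simp
  then obtain u w where uw: "u * int g1 + w * gcd (int g2) (int g3) = 1"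
    using bezout_int by metis
  obtain x y where xy: "x * int g2 + y * int g3 = gcd (int g2) (int g3)"
    using bezout_int by blast
  \<comment> \<open>Multiplying the Bezout identity by i writes i as ?p g2 + ?q g3 modulo g1.
    Reducing both coefficients modulo g1 makes them nonnegative and keeps the residue class.\<close>
  let ?p = "int i * w * x" and ?q = "int i * w * y"
  let ?s = "nat (?p mod int g1) * g2 + nat (?q mod int g1) * g3"
  have "int ?s = ?p mod int g1 * int g2 + ?q mod int g1 * int g3"
    using assms(2) by simp
  then have "int ?s mod int g1 = (?p * int g2 + ?q * int g3) mod int g1"
    using mod_add_cong[OF mod_mult_cong[OF mod_mod_trivial refl] mod_mult_cong[OF mod_mod_trivial refl]]
    by simp
  also have "?p * int g2 + ?q * int g3 = int i * (w * (x * int g2 + y * int g3))"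
    by (simp add: algebra_simps)
  also have "\<dots> = int i + (- int i * u) * int g1"
    using arg_cong[OF uw, of "\<lambda>m. int i * m"] unfolding xy by (simp add: algebra_simps)
  also have "\<dots> mod int g1 = int i mod int g1" by (rule mod_mult_self1)
  finally have "?s mod g1 = i mod g1"
    by (metis of_nat_eq_iff zmod_int)
  moreover have "?s \<in> semigroup_gen ?A"
    by (intro semigroup_gen_closed mult) auto
  ultimately show ?thesis by blast
qed

section \<open>Sums of three generators and torsion\<close>

lemma sum_list_three:
  assumes "set xs \<subseteq> {g1, g2, g3 :: nat}"
  obtains x y z where "sum_list xs = x * g1 + y * g2 + z * g3" "length xs = x + y + z"
proof -
  have "\<exists>x y z. sum_list xs = x * g1 + y * g2 + z * g3 \<and> length xs = x + y + z"
    using assms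
  proof (induction xs)
    case (Cons a xs)
    then obtain x y z where *: "sum_list xs = x * g1 + y * g2 + z * g3" "length xs = x + y + z"
      by auto
    consider "a = g1" | "a = g2" | "a = g3" using Cons.prems by auto
    then show ?case
    proof cases
      case 1
      then show ?thesis using * by (intro exI[of _ "Suc x"] exI[of _ y] exI[of _ z]) simp
    next
      case 2
      then show ?thesis using * by (intro exI[of _ x] exI[of _ "Suc y"] exI[of _ z]) simp
    next
      case 3
      then show ?thesis using * by (intro exI[of _ x] exI[of _ y] exI[of _ "Suc z"]) simp
    qed
  qed auto
  then show ?thesis using that by blast
qed

lemma long_sums_threeI:
  "n \<le> x + y + z \<Longrightarrow> x * g1 + y * g2 + z * g3 \<in> long_sums {g1, g2, g3} n"
  using long_sumsI[of "replicate x g1 @ replicate y g2 @ replicate z g3" "{g1, g2, g3}" n]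
  by (simp add: sum_list_replicate add.assoc set_replicate_conv_if)

lemma long_sums_threeE:
  assumes "s \<in> long_sums {g1, g2, g3} n"
  obtains x y z where "s = x * g1 + y * g2 + z * g3" "n \<le> x + y + z"
proof -
  from assms obtain xs where "set xs \<subseteq> {g1, g2, g3}" "n \<le> length xs" "s = sum_list xs"
    unfolding long_sums_def by blast
  then show ?thesis using that by (metis sum_list_three)
qed

context
  fixes g1 g2 g3 :: nat
  assumes g: "0 < g1" "g1 < g2" "g2 < g3"
begin

text \<open>Sums with at least $g_1$ summands $g_2$ (or $g_3$) get longer by trading $g_1$ copies of
  $g_2$ for $g_2$ copies of $g_1$. All other long sums contain $c$ copies of $g_1$.\<close>

lemma long_sums_torsion:
  assumes s: "s \<in> long_sums {g1, g2, g3} b" "s + c * g1 \<in> long_sums {g1, g2, g3} (Suc (b + c))"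
    and xs: "set xs \<subseteq> {g1, g2, g3}" "2 * g1 + c \<le> length xs"
  shows "s + sum_list xs \<in> long_sums {g1, g2, g3} (Suc (b + length xs))"
proof -
  let ?L = "long_sums {g1, g2, g3}"
  obtain x y z where xyz: "sum_list xs = x * g1 + y * g2 + z * g3" "length xs = x + y + z"
    using xs(1) by (rule sum_list_three)
  \<comment> \<open>The bound 2 g1 + c on the length is chosen for this pigeonhole argument.\<close>
  have "g1 \<le> y \<or> g1 \<le> z \<or> c \<le> x" using xs(2) xyz(2) by linarith
  then consider y' where "y = g1 + y'" | z' where "z = g1 + z'" | x' where "x = c + x'"
    using le_Suc_ex by blast
  then show ?thesis
  proof cases
    case 1
    have "(x + g2) * g1 + y' * g2 + z * g3 \<in> ?L (Suc (length xs))"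
      using g 1 xyz(2) by (intro long_sums_threeI) simp
    also have "(x + g2) * g1 + y' * g2 + z * g3 = sum_list xs"
      using 1 xyz(1) by (simp add: algebra_simps)
    finally show ?thesis using long_sums_add[OF s(1)] by fastforce
  next
    case 2
    have "(x + g3) * g1 + y * g2 + z' * g3 \<in> ?L (Suc (length xs))"
      using g 2 xyz(2) by (intro long_sums_threeI) simp
    also have "(x + g3) * g1 + y * g2 + z' * g3 = sum_list xs"
      using 2 xyz(1) by (simp add: algebra_simps)
    finally show ?thesis using long_sums_add[OF s(1)] by fastforce
  next
    case 3
    \<comment> \<open>The c copies of g1 go to s, where the second assumption in \<open>s\<close>
      provides the additional summand.\<close>
    have "x' * g1 + y * g2 + z * g3 \<in> ?L (x' + y + z)"
      by (rule long_sums_threeI) simp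
    from long_sums_add[OF s(2) this] show ?thesis
      using 3 xyz by (simp add: algebra_simps)
  qed
qed

lemma graded_buchsbaum_torsion:
  assumes "graded_buchsbaum (semigroup_ring (semigroup_gen {g1, g2, g3}) :: 'k::field fps ring)
      (semigroup_max_ideal (semigroup_gen {g1, g2, g3}) {g1, g2, g3})"
    and "s \<in> long_sums {g1, g2, g3} b" "s + c * g1 \<in> long_sums {g1, g2, g3} (Suc (b + c))"
    and "a \<in> {g1, g2, g3}"
  shows "s + a \<in> long_sums {g1, g2, g3} (Suc (Suc b))"
  using graded_buchsbaum_long_sums[OF assms(1,2,4) long_sums_torsion[OF assms(2,3)]] by blast

text \<open>Adding (y + z) g1 to a representation x g1 + y (g2 - g1) + z (g3 - g1) of the Apery
  element of S' turns it into x g1 + y g2 + z g3. The element y g2 + z g3 of S is then the Apery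
  element of S plus c g1, and its y + z summands are more than b + c because a_i > b.\<close>

lemma apery_torsion:
  assumes "Gcd {g1, g2, g3} = 1"
  defines "S \<equiv> semigroup_gen {g1, g2, g3}"
    and "S' \<equiv> semigroup_gen {g1, g2 - g1, g3 - g1}"
  assumes ab: "int b < apery_a S S' g1 i"
  obtains c where "apery S g1 i + c * g1 \<in> long_sums {g1, g2, g3} (Suc (b + c))"
proof -
  obtain s where s: "s \<in> S" "s mod g1 = i mod g1"
    using semigroup_gen_residues assms(1) g unfolding S_def by blast
  \<comment> \<open>S is contained in S', since g2 = g1 + (g2 - g1) and likewise for g3. So s is a
    witness for the class of i in both semigroups.\<close>
  from s(1) have "s \<in> S'"
    unfolding S_def
  proof induction
    case (add a t)
    have "g1 + (g2 - g1) \<in> S'" "g1 + (g3 - g1) \<in> S'"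
      unfolding S'_def using semigroup_gen.add[OF _ semigroup_gen.add[OF _ semigroup_gen.zero]]
      by (metis add.right_neutral insertCI)+
    then have "a \<in> S'"
      using add.hyps g semigroup_gen.add[OF _ semigroup_gen.zero, of g1 "{g1, g2 - g1, g3 - g1}"]
      by (auto simp: S'_def)
    then show ?case
      using semigroup_gen_closed add.IH unfolding S'_def by blast
  qed (simp add: S'_def semigroup_gen.zero)
  note a = apery_a_eq[OF g(1) s this s(2)] and \<omega>' = apery[OF this s(2)] and \<omega> = apery[OF s]
  obtain x y z where xyz: "apery S' g1 i = x * g1 + y * (g2 - g1) + z * (g3 - g1)"
    using \<omega>'(1) unfolding S'_def long_sums_0[symmetric] by (rule long_sums_threeE)
  have "y * g2 = y * (g2 - g1) + y * g1" "z * g3 = z * (g3 - g1) + z * g1"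
    using g by (simp_all flip: distrib_left)
  then have lift: "apery S' g1 i + (y + z) * g1 = x * g1 + (y * g2 + z * g3)"
    unfolding xyz by (simp add: algebra_simps)
  \<comment> \<open>This integer solves \<omega>_i + c g1 = y g2 + z g3. It is nonnegative by
    minimality of \<omega>_i, as the right-hand side lies in S and in the same residue
    class.\<close>
  define c where "c = int (y + z) - apery_a S S' g1 i - int x"
  have eq: "int (apery S g1 i) + c * int g1 = int (y * g2 + z * g3)"
    using a arg_cong[OF lift, of int] unfolding c_def by (simp add: algebra_simps)
  have "y * g2 + z * g3 \<in> S"
    using long_sums_threeI[of 0 0 y z g1 g2 g3] unfolding S_def long_sums_0 by simp
  moreover have "(y * g2 + z * g3) mod g1 = i mod g1"
    using \<omega>'(2) arg_cong[OF lift, of "\<lambda>n. n mod g1"] by simp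
  ultimately have "apery S g1 i \<le> y * g2 + z * g3" by (rule apery(3))
  then have "0 \<le> c * int g1" using eq by linarith
  then have "0 \<le> c" using g(1) by (simp add: zero_le_mult_iff)
  have "apery S g1 i + nat c * g1 = 0 * g1 + y * g2 + z * g3"
    using eq \<open>0 \<le> c\<close> by (simp flip: of_nat_eq_iff[where 'a = int])
  moreover have "Suc (b + nat c) \<le> 0 + y + z"
    using ab \<open>0 \<le> c\<close> unfolding c_def by linarith
  ultimately show ?thesis
    using that[of "nat c"] long_sums_threeI by metis
qed

section \<open>Apery elements with a_i > b_i\<close>

lemma apery_mem:
  assumes "Gcd {g1, g2, g3} = 1"
  shows "apery (semigroup_gen {g1, g2, g3}) g1 i \<in> semigroup_gen {g1, g2, g3}"
  using semigroup_gen_residues[OF assms g(1)] apery(1) by blast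

text \<open>Removing one copy of g1 would leave a smaller element of S in the same residue
  class.\<close>

lemma apery_representation:
  assumes "Gcd {g1, g2, g3} = 1"
    and \<omega>: "apery (semigroup_gen {g1, g2, g3}) g1 i = x * g1 + y * g2 + z * g3"
  shows "x = 0"
proof (rule ccontr)
  assume "x \<noteq> 0"
  then obtain x' where x: "x = Suc x'" by (cases x) auto
  let ?S = "semigroup_gen {g1, g2, g3}" and ?t = "x' * g1 + y * g2 + z * g3"
  have t: "?t \<in> ?S"
    using long_sums_threeI[of 0 x' y z g1 g2 g3] by (simp add: long_sums_0)
  have \<omega>t: "apery ?S g1 i = ?t + g1"
    using \<omega> x by simp
  have "apery ?S g1 i mod g1 = i mod g1"
    using semigroup_gen_residues[OF assms(1) g(1)] apery(2) by blast
  then have "?t mod g1 = i mod g1"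
    unfolding \<omega>t by simp
  from apery(3)[OF t this] show False
    using \<omega>t g(1) by simp
qed

text \<open>The second and third conclusions serve to compare two such Apery elements.\<close>

lemma graded_buchsbaum_apery:
  defines "S \<equiv> semigroup_gen {g1, g2, g3}"
    and "S' \<equiv> semigroup_gen {g1, g2 - g1, g3 - g1}"
  assumes gcd: "Gcd {g1, g2, g3} = 1"
    and buchsbaum: "graded_buchsbaum (semigroup_ring S :: 'k::field fps ring)
      (semigroup_max_ideal S {g1, g2, g3})"
    and ab: "int (apery_b S g1 i) < apery_a S S' g1 i"
  shows "apery S g1 i = h * g2 + k * g3 \<Longrightarrow> h = 0"
    and "apery S g1 i = apery_b S g1 i * g3"
    and "a \<in> {g1, g2, g3} \<Longrightarrow>
      apery S g1 i + a \<in> long_sums {g1, g2, g3} (Suc (Suc (apery_b S g1 i)))"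
proof -
  let ?L = "long_sums {g1, g2, g3}"
  define \<omega> where "\<omega> = apery S g1 i"
  define b where "b = apery_b S g1 i"
  have \<omega>S: "\<omega> \<in> S" using apery_mem[OF gcd] by (simp add: \<omega>_def S_def)
  have zero: "0 \<notin> {g1, g2, g3}" using g by auto
  have \<omega>b: "\<omega> \<in> ?L b" and b_max: "\<And>n. \<omega> \<in> ?L n \<Longrightarrow> n \<le> b"
    using adic_order[OF zero \<omega>S[unfolded S_def]] by (simp_all add: b_def apery_b_def S_def \<omega>_def)
  note buchsbaum = graded_buchsbaum_torsion[OF buchsbaum[unfolded S_def]]
  obtain c where c: "\<omega> + c * g1 \<in> ?L (Suc (b + c))"
    using apery_torsion[OF gcd] ab unfolding \<omega>_def b_def S_def S'_def by blast
  have step: "\<omega> + a \<in> ?L (Suc (Suc b))" if "a \<in> {g1, g2, g3}" for a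
    by (rule buchsbaum[OF \<omega>b c that])
  obtain x h' k' where "\<omega> = x * g1 + h' * g2 + k' * g3" "b \<le> x + h' + k'"
    using \<omega>b by (rule long_sums_threeE)
  moreover from this have "x = 0"
    using apery_representation[OF gcd] unfolding \<omega>_def S_def by blast
  ultimately have rep: "\<omega> = h' * g2 + k' * g3" "b \<le> h' + k'" by simp_all
  \<comment> \<open>The representation comes from membership in bM and has at least b summands;
    maximality of b excludes more.\<close>
  have b: "h' + k' = b"
    using rep b_max[of "h' + k'"] long_sums_threeI[of "h' + k'" 0 h' k' g1 g2 g3] by simp
  have h': "h' = 0"
  proof (rule ccontr)
    assume "h' \<noteq> 0"
    then obtain h'' where h'': "h' = Suc h''" by (cases h') auto
    define t where "t = h'' * g2 + k' * g3"
    have \<omega>t: "\<omega> = t + g2" using rep h'' by (simp add: t_def)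
    obtain b' where b': "b = Suc b'" "b' = h'' + k'" using b h'' by simp
    have t: "t \<in> ?L b'"
      using long_sums_threeI[of b' 0 h'' k' g1 g2 g3] b' by (simp add: t_def)
    obtain x y z where xyz: "\<omega> + g1 = x * g1 + y * g2 + z * g3" "Suc (Suc b) \<le> x + y + z"
      using step[of g1] by (auto elim: long_sums_threeE)
    \<comment> \<open>Otherwise g1 cancels on both sides and \<omega> becomes a sum of at least b +
      1 generators.\<close>
    have "x = 0"
    proof (rule ccontr)
      assume "x \<noteq> 0"
      then obtain x' where "x = Suc x'" by (cases x) auto
      then have "\<omega> = x' * g1 + y * g2 + z * g3" "Suc b \<le> x' + y + z" using xyz by simp_all
      then have "\<omega> \<in> ?L (Suc b)" using long_sums_threeI by metis
      then show False using b_max by fastforce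
    qed
    \<comment> \<open>A sum of copies of g3 alone would be at least (b + 2) g3, whereas \<omega> <=
      b g3 and g1 < g3.\<close>
    moreover have "y \<noteq> 0"
    proof
      assume "y = 0"
      then have "Suc (Suc b) \<le> z" using xyz \<open>x = 0\<close> by simp
      then have "Suc (Suc b) * g3 \<le> z * g3" by (rule mult_le_mono1)
      then have "Suc (Suc b) * g3 \<le> \<omega> + g1" using xyz \<open>x = 0\<close> \<open>y = 0\<close> by simp
      moreover have "Suc (Suc b) * g3 = h' * g3 + k' * g3 + g3 + g3"
        unfolding b[symmetric] by (simp add: algebra_simps)
      moreover have "h' * g2 \<le> h' * g3" using g by simp
      ultimately show False using rep(1) g by linarith
    qed
    ultimately obtain y' where "x = 0" "y = Suc y'" by (cases y) auto
    \<comment> \<open>Cancelling g2 on both sides leaves at least b + 1 = b' + 2 summands, so t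
      satisfies the torsion criterion in degree b' with c = 1. Adding g2 back then gives \<omega> in
      (b + 1)M.\<close>
    then have "t + 1 * g1 = 0 * g1 + y' * g2 + z * g3" "Suc (b' + 1) \<le> 0 + y' + z"
      using xyz \<omega>t b' by simp_all
    then have "t + 1 * g1 \<in> ?L (Suc (b' + 1))" using long_sums_threeI by metis
    then have "\<omega> \<in> ?L (Suc b)"
      using buchsbaum[OF t, of 1 g2] b' \<omega>t by simp
    then show False using b_max by fastforce
  qed
  \<comment> \<open>So far only a representation with b summands has been treated, giving \<omega> =
    b g3. Any other one has at most b summands, and a summand g2 < g3 would make it smaller than b
    g3.\<close>
  show "h = 0" if "apery S g1 i = h * g2 + k * g3"
  proof (rule ccontr)
    assume "h \<noteq> 0"
    have eq: "h * g2 + k * g3 = b * g3"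
      using that rep(1) b h' by (simp add: \<omega>_def)
    have "h + k \<le> b"
      using b_max[of "h + k"] long_sums_threeI[of "h + k" 0 h k g1 g2 g3] that by (simp add: \<omega>_def)
    then have "h * g3 + k * g3 \<le> b * g3"
      by (metis distrib_right mult_le_mono1)
    moreover have "h * g2 < h * g3" using \<open>h \<noteq> 0\<close> g by simp
    ultimately show False using eq by linarith
  qed
  show "apery S g1 i = apery_b S g1 i * g3"
    using rep(1) b h' by (simp add: \<omega>_def b_def)
  show "apery S g1 i + a \<in> ?L (Suc (Suc (apery_b S g1 i)))" if "a \<in> {g1, g2, g3}"
    using step[OF that] by (simp add: \<omega>_def b_def)
qed

text \<open>If b_j = b_i + 1 + d, then \<omega>_j = (\<omega>_i + g3) + d g3. The bracket lies in
  (b_i + 2)M, so \<omega>_j would lie in (b_j + 1)M, against the maximality of b_j.\<close>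

lemma graded_buchsbaum_apery_b_le:
  defines "S \<equiv> semigroup_gen {g1, g2, g3}"
    and "S' \<equiv> semigroup_gen {g1, g2 - g1, g3 - g1}"
  assumes gcd: "Gcd {g1, g2, g3} = 1"
    and buchsbaum: "graded_buchsbaum (semigroup_ring S :: 'k::field fps ring)
      (semigroup_max_ideal S {g1, g2, g3})"
    and ab: "int (apery_b S g1 i) < apery_a S S' g1 i" "int (apery_b S g1 j) < apery_a S S' g1 j"
  shows "apery_b S g1 j \<le> apery_b S g1 i"
proof (rule ccontr)
  let ?L = "long_sums {g1, g2, g3}" and ?b = "apery_b S g1"
  note props = graded_buchsbaum_apery[OF gcd buchsbaum[unfolded S_def], folded S_def S'_def]
  assume "\<not> ?b j \<le> ?b i"
  then obtain d where d: "?b j = Suc (?b i + d)"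
    by (metis less_imp_Suc_add not_le)
  have "apery S g1 i + g3 \<in> ?L (Suc (Suc (?b i)))"
    by (rule props(3)[OF ab(1)]) simp
  moreover have "0 * g1 + 0 * g2 + d * g3 \<in> ?L d"
    by (rule long_sums_threeI) simp
  ultimately have "apery S g1 i + g3 + (0 * g1 + 0 * g2 + d * g3) \<in> ?L (Suc (Suc (?b i)) + d)"
    by (rule long_sums_add)
  also have "apery S g1 i + g3 + (0 * g1 + 0 * g2 + d * g3) = apery S g1 j"
    unfolding props(2)[OF ab(1)] props(2)[OF ab(2)] d by (simp add: algebra_simps)
  finally have "apery S g1 j \<in> ?L (Suc (?b j))" using d by simp
  then have "Suc (?b j) \<le> ?b j"
    unfolding apery_b_def S_def using adic_order(2)[of "{g1, g2, g3}"] apery_mem[OF gcd] g by auto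
  then show False by simp
qed

end

theorem theorem4p1:
  fixes S S' :: "nat set" and g1 g2 g3 :: nat
  assumes "infinite (UNIV :: 'k::field set)"
    and "g1 < g2" and "g2 < g3" and "Gcd {g1, g2, g3} = 1"
    and "minimal_generators {g1, g2, g3} S"
    and "S' = semigroup_gen {g1, g2 - g1, g3 - g1}"
    and "graded_buchsbaum (semigroup_ring S :: 'k fps ring) (semigroup_max_ideal S {g1, g2, g3})"
  shows "(\<forall>i < g1. \<forall>h k. apery S g1 i = h * g2 + k * g3 \<and> apery_a S S' g1 i > int (apery_b S g1 i)
            \<longrightarrow> h = 0)
       \<and> card {apery S g1 i | i. i < g1 \<and> apery_a S S' g1 i > int (apery_b S g1 i)} \<le> 1"
proof -
  have S: "S = semigroup_gen {g1, g2, g3}"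
    using assms(5) by (simp add: minimal_generators_def)
  \<comment> \<open>Positivity of g1 comes from minimality of the generators, which excludes
    0.\<close>
  have g: "0 < g1" "g1 < g2" "g2 < g3"
    using zero_notin_minimal_generators[OF assms(5)] assms(2,3) by auto
  note props = graded_buchsbaum_apery[OF g assms(4) assms(7)[unfolded S], folded S assms(6)]
  \<comment> \<open>The inequality in both directions gives b_i = b_j, and both Apery elements equal
    this number times g3.\<close>
  have "apery S g1 i = apery S g1 j"
    if "int (apery_b S g1 i) < apery_a S S' g1 i" "int (apery_b S g1 j) < apery_a S S' g1 j" for i j
    using graded_buchsbaum_apery_b_le[OF g assms(4) assms(7)[unfolded S], folded S assms(6)] that
      props(2) by (metis le_antisym)
  then have "card {apery S g1 i | i. i < g1 \<and> apery_a S S' g1 i > int (apery_b S g1 i)} \<le> Suc 0"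
    by (subst card_le_Suc0_iff_eq) auto
  then show ?thesis using props(1) by auto
qed

end
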